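(* Let $G$ be a finite group and let $L$ be an involutive antiautomorphism of $G$ such that $L(g)$ is conjugate to $g$ for all $g\in G$. Let $L^\ast$ be the linear automorphism of $L^2(G)$ defined by $L^\ast(f)=f\circ L$. Then: (i) $\rho_g\circ L^\ast = L^\ast\circ\sigma_{L(g)^{-1}}$ for all $g\in G$; (ii) $\mathrm{Tr}(\rho_g\circ L^\ast) = |\{h\in G : h^{-1}L(h)=g\}|$ for all $g\in G$; (iii) $\mathrm{Tr}(\rho_g\circ L^\ast)=\mathrm{Tr}(\rho_{g^{-1}}\circ L^\ast)$ for all $g\in G$; (iv) there are signs $\varepsilon_k\in\{1,-1\}$, $1\le k\le r$ (independent of $g$), such that $\mathrm{Tr}(\rho_g\circ L^\ast)=\sum_{k=1}^r\varepsilon_k\chi_k(g)$ for all $g\in G$.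
   Context: $L^2(G)$ is the complex vector space of all functions $G\to\mathbb{C}$. $\rho$ and $\sigma$ are the right and left regular representations of $G$ on $L^2(G)$: $(\rho_g f)(h)=f(hg)$ and $(\sigma_g f)(h)=f(g^{-1}h)$. An involutive antiautomorphism of $G$ is a bijection $L:G\to G$ with $L(gh)=L(h)L(g)$ and $L(L(g))=g$ for all $g,h\in G$. $\chi_1,\dots,\chi_r$ are the irreducible complex characters of $G$, each listed once. *)

theory Defs
  imports "Jordan_Normal_Form.VS_Connect"
begin

section \<open>The space of complex functions on a group\<close>

text \<open>A function on the carrier of \<open>G\<close> is represented by its unique extension that is
  \<^const>\<open>undefined\<close> outside the carrier, so that equality in \<open>L2 G\<close> is pointwise equality
  on the carrier.\<close>

definition L2 :: "('a, 'b) monoid_scheme \<Rightarrow> ('a \<Rightarrow> complex) set" where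
  "L2 G = (carrier G \<rightarrow>\<^sub>E UNIV)"

definition right_regular ::
    "('a, 'b) monoid_scheme \<Rightarrow> 'a \<Rightarrow> ('a \<Rightarrow> complex) \<Rightarrow> ('a \<Rightarrow> complex)" where
  "right_regular G g f = (\<lambda>h\<in>carrier G. f (h \<otimes>\<^bsub>G\<^esub> g))"

definition left_regular ::
    "('a, 'b) monoid_scheme \<Rightarrow> 'a \<Rightarrow> ('a \<Rightarrow> complex) \<Rightarrow> ('a \<Rightarrow> complex)" where
  "left_regular G g f = (\<lambda>h\<in>carrier G. f (inv\<^bsub>G\<^esub> g \<otimes>\<^bsub>G\<^esub> h))"

definition pullback ::
    "('a, 'b) monoid_scheme \<Rightarrow> ('a \<Rightarrow> 'a) \<Rightarrow> ('a \<Rightarrow> complex) \<Rightarrow> ('a \<Rightarrow> complex)" where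
  "pullback G L f = (\<lambda>h\<in>carrier G. f (L h))"

definition involutive_antiautomorphism :: "('a, 'b) monoid_scheme \<Rightarrow> ('a \<Rightarrow> 'a) \<Rightarrow> bool" where
  "involutive_antiautomorphism G L \<longleftrightarrow>
     bij_betw L (carrier G) (carrier G) \<and>
     (\<forall>g\<in>carrier G. \<forall>h\<in>carrier G. L (g \<otimes>\<^bsub>G\<^esub> h) = L h \<otimes>\<^bsub>G\<^esub> L g) \<and>
     (\<forall>g\<in>carrier G. L (L g) = g)"

definition conjugate_in :: "('a, 'b) monoid_scheme \<Rightarrow> 'a \<Rightarrow> 'a \<Rightarrow> bool" where
  "conjugate_in G a b \<longleftrightarrow> (\<exists>x\<in>carrier G. a = x \<otimes>\<^bsub>G\<^esub> b \<otimes>\<^bsub>G\<^esub> inv\<^bsub>G\<^esub> x)"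


section \<open>Linear operators and their traces\<close>

definition L2_lincomb ::
    "('a, 'b) monoid_scheme \<Rightarrow> complex \<Rightarrow> ('a \<Rightarrow> complex) \<Rightarrow> complex \<Rightarrow> ('a \<Rightarrow> complex)
      \<Rightarrow> ('a \<Rightarrow> complex)" where
  "L2_lincomb G a f b f' = (\<lambda>x\<in>carrier G. a * f x + b * f' x)"

definition L2_linear ::
    "('a, 'b) monoid_scheme \<Rightarrow> (('a \<Rightarrow> complex) \<Rightarrow> ('a \<Rightarrow> complex)) \<Rightarrow> bool" where
  "L2_linear G T \<longleftrightarrow> T \<in> L2 G \<rightarrow> L2 G \<and>
     (\<forall>f\<in>L2 G. \<forall>f'\<in>L2 G. \<forall>a b. T (L2_lincomb G a f b f') = L2_lincomb G a (T f) b (T f'))"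

definition L2_delta :: "('a, 'b) monoid_scheme \<Rightarrow> 'a \<Rightarrow> ('a \<Rightarrow> complex)" where
  "L2_delta G x = (\<lambda>y\<in>carrier G. if y = x then 1 else 0)"

text \<open>The sum of the diagonal entries of the matrix of \<open>T\<close> with respect to the basis of delta
  functions. For linear \<open>T\<close> every other basis gives the same value, see \<open>L2_trace_any_basis\<close>.\<close>

definition L2_trace ::
    "('a, 'b) monoid_scheme \<Rightarrow> (('a \<Rightarrow> complex) \<Rightarrow> ('a \<Rightarrow> complex)) \<Rightarrow> complex" where
  "L2_trace G T = (\<Sum>x\<in>carrier G. T (L2_delta G x) x)"


section \<open>Irreducible characters\<close>

definition matrix_rep :: "('a, 'b) monoid_scheme \<Rightarrow> nat \<Rightarrow> ('a \<Rightarrow> complex mat) \<Rightarrow> bool" where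
  "matrix_rep G n R \<longleftrightarrow>
     (\<forall>g\<in>carrier G. R g \<in> carrier_mat n n) \<and>
     R \<one>\<^bsub>G\<^esub> = 1\<^sub>m n \<and>
     (\<forall>g\<in>carrier G. \<forall>h\<in>carrier G. R (g \<otimes>\<^bsub>G\<^esub> h) = R g * R h)"

definition irreducible_matrix_rep ::
    "('a, 'b) monoid_scheme \<Rightarrow> nat \<Rightarrow> ('a \<Rightarrow> complex mat) \<Rightarrow> bool" where
  "irreducible_matrix_rep G n R \<longleftrightarrow>
     matrix_rep G n R \<and> 0 < n \<and>
     (\<forall>W. VectorSpace.subspace class_ring W (module_vec TYPE(complex) n) \<and>
          (\<forall>g\<in>carrier G. \<forall>w\<in>W. R g *\<^sub>v w \<in> W) \<longrightarrow>
          W = {0\<^sub>v n} \<or> W = carrier_vec n)"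

definition rep_character ::
    "('a, 'b) monoid_scheme \<Rightarrow> nat \<Rightarrow> ('a \<Rightarrow> complex mat) \<Rightarrow> ('a \<Rightarrow> complex)" where
  "rep_character G n R = (\<lambda>g\<in>carrier G. \<Sum>i<n. R g $$ (i, i))"

definition irreducible_characters :: "('a, 'b) monoid_scheme \<Rightarrow> ('a \<Rightarrow> complex) set" where
  "irreducible_characters G = {rep_character G n R | n R. irreducible_matrix_rep G n R}"


section \<open>Basic properties\<close>

lemma L2_restrict [simp]: "restrict f (carrier G) \<in> L2 G"
  by (simp add: L2_def)

lemma L2_eqI:
  assumes "f \<in> L2 G" "f' \<in> L2 G" "\<And>x. x \<in> carrier G \<Longrightarrow> f x = f' x"
  shows "f = f'"
  using assms unfolding L2_def by (meson PiE_ext)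

lemma L2_linear_pullback:
  assumes "involutive_antiautomorphism G L"
  shows "L2_linear G (pullback G L)" and "bij_betw (pullback G L) (L2 G) (L2 G)"
proof -
  have L: "\<And>x. x \<in> carrier G \<Longrightarrow> L x \<in> carrier G" "\<And>x. x \<in> carrier G \<Longrightarrow> L (L x) = x"
    using assms bij_betwE unfolding involutive_antiautomorphism_def by blast+
  show "L2_linear G (pullback G L)"
    unfolding L2_linear_def L2_lincomb_def pullback_def using L by (auto simp: fun_eq_iff)
  have inv: "pullback G L (pullback G L f) = f" if "f \<in> L2 G" for f
    by (rule L2_eqI[OF _ that]) (auto simp: pullback_def L)
  show "bij_betw (pullback G L) (L2 G) (L2 G)"
    by (rule bij_betwI[where g = "pullback G L"]) (auto simp: inv, auto simp: pullback_def)
qed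

text \<open>A basis of \<open>L2 G\<close> is given here as a finite family \<open>v\<close> together with its coordinate
  functionals \<open>c\<close>.\<close>

lemma L2_trace_any_basis:
  fixes c :: "'i \<Rightarrow> ('a \<Rightarrow> complex) \<Rightarrow> complex"
  assumes fin: "finite (carrier G)" and "finite I" and T: "L2_linear G T"
    and v: "\<And>i. i \<in> I \<Longrightarrow> v i \<in> L2 G"
    and c: "\<And>i f f' a b. \<lbrakk>i \<in> I; f \<in> L2 G; f' \<in> L2 G\<rbrakk>
              \<Longrightarrow> c i (L2_lincomb G a f b f') = a * c i f + b * c i f'"
    and coord: "\<And>f x. \<lbrakk>f \<in> L2 G; x \<in> carrier G\<rbrakk> \<Longrightarrow> f x = (\<Sum>i\<in>I. c i f * v i x)"
  shows "L2_trace G T = (\<Sum>i\<in>I. c i (T (v i)))"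
proof -
  have T_mem: "T f \<in> L2 G" if "f \<in> L2 G" for f
    using T that unfolding L2_linear_def by auto
  have d_mem: "L2_delta G x \<in> L2 G" for x
    by (simp add: L2_delta_def)
  have expand: "\<phi> f = (\<Sum>x\<in>carrier G. f x * \<phi> (L2_delta G x))"
    if \<phi>: "\<And>f f' a b. \<lbrakk>f \<in> L2 G; f' \<in> L2 G\<rbrakk> \<Longrightarrow> \<phi> (L2_lincomb G a f b f') = a * \<phi> f + b * \<phi> f'"
      and f: "f \<in> L2 G" for \<phi> :: "('a \<Rightarrow> complex) \<Rightarrow> complex" and f
  proof -
    have *: "\<phi> (\<lambda>y\<in>carrier G. if y \<in> A then f y else 0) = (\<Sum>x\<in>A. f x * \<phi> (L2_delta G x))"
      if "finite A" "A \<subseteq> carrier G" for A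
      using that
    proof (induction A rule: finite_induct)
      case empty
      let ?z = "\<lambda>y\<in>carrier G. 0 :: complex"
      have "\<phi> (L2_lincomb G 0 ?z 0 ?z) = 0" by (subst \<phi>) auto
      then show ?case by (simp add: L2_lincomb_def restrict_def)
    next
      case (insert x A)
      let ?h = "\<lambda>y\<in>carrier G. if y \<in> A then f y else 0"
      have "(\<lambda>y\<in>carrier G. if y \<in> insert x A then f y else 0)
              = L2_lincomb G (f x) (L2_delta G x) 1 ?h"
        using insert.hyps by (auto simp: L2_lincomb_def L2_delta_def fun_eq_iff)
      moreover have "\<phi> ?h = (\<Sum>x\<in>A. f x * \<phi> (L2_delta G x))"
        using insert.prems by (intro insert.IH) auto
      ultimately show ?case using insert.hyps d_mem by (simp only: \<phi> L2_restrict sum.insert mult_1 not_False_eq_True)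
    qed
    have "(\<lambda>y\<in>carrier G. if y \<in> carrier G then f y else 0) = f"
      by (rule L2_eqI[OF _ f]) auto
    then show ?thesis using *[OF fin subset_refl] by simp
  qed
  have "c i (T (v i)) = (\<Sum>x\<in>carrier G. v i x * c i (T (L2_delta G x)))" if "i \<in> I" for i
    by (rule expand[where \<phi> = "\<lambda>f. c i (T f)"])
      (use T T_mem that v c in \<open>auto simp: L2_linear_def\<close>)
  then have "(\<Sum>i\<in>I. c i (T (v i)))
      = (\<Sum>i\<in>I. \<Sum>x\<in>carrier G. v i x * c i (T (L2_delta G x)))" by simp
  also have "\<dots> = (\<Sum>x\<in>carrier G. \<Sum>i\<in>I. c i (T (L2_delta G x)) * v i x)"
    by (subst sum.swap) (simp add: mult.commute)
  also have "\<dots> = L2_trace G T"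
    unfolding L2_trace_def by (intro sum.cong refl coord[symmetric] T_mem d_mem)
  finally show ?thesis by simp
qed

end

theory Submission
  imports Defs "Jordan_Normal_Form.Spectral_Radius"
begin

text \<open>The trace counts the \<open>h\<close> with \<open>h\<^sup>-\<^sup>1 L(h) = g\<close>, and \<open>L\<close> maps the solutions for \<open>g\<close> to
  those for \<open>g\<^sup>-\<^sup>1\<close>. To expand the count in characters, write the indicator of the unit as
  \<open>|G|\<^sup>-\<^sup>1 \<Sum>\<^sub>\<psi> \<psi>(1) \<psi>\<close>, the decomposition of the regular character. For an irreducible
  representation \<open>R\<close> of dimension \<open>n\<close>, the representation \<open>g \<mapsto> R(L g)\<^sup>T\<close> has the same character
  as \<open>R\<close>, since \<open>L g\<close> is conjugate to \<open>g\<close>; hence it equals \<open>T R(g) T\<^sup>-\<^sup>1\<close> for some \<open>T\<close>.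
  Transposing shows that \<open>T\<^sup>T\<close> is an intertwiner too, so by Schur's lemma \<open>T\<^sup>T = \<epsilon> T\<close> with
  \<open>\<epsilon>\<^sup>2 = 1\<close>, and Schur orthogonality turns \<open>\<Sum>\<^sub>h R(h\<^sup>-\<^sup>1) R(L h)\<close> into the scalar \<open>\<epsilon> |G| / n\<close>.\<close>

section \<open>Matrices\<close>

lemma mult_mat_entry:
  assumes "A \<in> carrier_mat n m" "B \<in> carrier_mat m k" "i < n" "j < k"
  shows "(A * B) $$ (i, j) = (\<Sum>p<m. A $$ (i, p) * B $$ (p, j))"
  using assms by (simp add: scalar_prod_def atLeast0LessThan)

lemma mult_mat_vec_entry:
  assumes "A \<in> carrier_mat n m" "v \<in> carrier_vec m" "i < n"
  shows "(A *\<^sub>v v) $ i = (\<Sum>p<m. A $$ (i, p) * v $ p)"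
  using assms by (simp add: scalar_prod_def atLeast0LessThan)

lemma mat_mult_unit_vec:
  fixes A :: "'b :: comm_ring_1 mat"
  assumes "A \<in> carrier_mat n m" "i < m"
  shows "A *\<^sub>v unit_vec m i = col A i"
  using assms by (intro eq_vecI) auto

lemma zero_mat_mult_vec:
  "v \<in> carrier_vec m \<Longrightarrow> 0\<^sub>m n m *\<^sub>v v = (0\<^sub>v n :: 'b :: comm_ring_1 vec)"
  by (intro eq_vecI) auto

lemma mat_zero_if_vanishes:
  fixes A :: "'b :: comm_ring_1 mat"
  assumes A: "A \<in> carrier_mat n m" and "\<And>v. v \<in> carrier_vec m \<Longrightarrow> A *\<^sub>v v = 0\<^sub>v n"
  shows "A = 0\<^sub>m n m"
proof (rule eq_matI)
  fix i j assume "i < dim_row (0\<^sub>m n m :: 'b mat)" "j < dim_col (0\<^sub>m n m :: 'b mat)"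
  then have ij: "i < n" "j < m" by auto
  then have "col A j = 0\<^sub>v n" using assms(2)[of "unit_vec m j"] mat_mult_unit_vec[OF A] by simp
  then have "col A j $ i = 0" using ij by simp
  then show "A $$ (i, j) = 0\<^sub>m n m $$ (i, j)" using A ij by simp
qed (use A in auto)

lemma eq_mat_if_minus_zero:
  fixes A :: "'b :: ab_group_add mat"
  assumes "A \<in> carrier_mat n m" "B \<in> carrier_mat n m" "A - B = 0\<^sub>m n m"
  shows "A = B"
proof (rule eq_matI)
  fix i j assume "i < dim_row B" "j < dim_col B"
  moreover from this have "(A - B) $$ (i, j) = 0" using assms by auto
  ultimately show "A $$ (i, j) = B $$ (i, j)" using assms(1,2) by simp
qed (use assms in auto)

definition mat_trace :: "'b :: comm_ring_1 mat \<Rightarrow> 'b" where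
  "mat_trace A = (\<Sum>i<dim_row A. A $$ (i, i))"

lemma mat_trace_mult_commute:
  assumes "A \<in> carrier_mat n m" "B \<in> carrier_mat m n"
  shows "mat_trace (A * B) = mat_trace (B * A)"
proof -
  have "mat_trace (A * B) = (\<Sum>i<n. \<Sum>p<m. A $$ (i, p) * B $$ (p, i))"
    using assms by (simp add: mat_trace_def mult_mat_entry del: index_mult_mat(1))
  also have "\<dots> = (\<Sum>p<m. \<Sum>i<n. B $$ (p, i) * A $$ (i, p))"
    by (subst sum.swap) (simp add: mult.commute)
  also have "\<dots> = mat_trace (B * A)"
    using assms by (simp add: mat_trace_def mult_mat_entry del: index_mult_mat(1))
  finally show ?thesis .
qed

text \<open>Cyclicity of the trace. Allowing rectangular \<open>P\<close> and \<open>Q\<close> lets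
  \<open>schur_isomorphism\<close> compare traces of representations whose dimensions have not been
  shown equal.\<close>

lemma mat_trace_similar:
  assumes "A \<in> carrier_mat n n" "P \<in> carrier_mat m n" "Q \<in> carrier_mat n m" "Q * P = 1\<^sub>m n"
  shows "mat_trace (P * A * Q) = mat_trace A"
proof -
  have "mat_trace (P * A * Q) = mat_trace (Q * (P * A))"
    using assms by (intro mat_trace_mult_commute) auto
  also have "Q * (P * A) = A"
    using assms assoc_mult_mat[of Q n m P n A n] by simp
  finally show ?thesis .
qed

lemma inverse_mat_if_det_nonzero:
  fixes P :: "'b :: field mat"
  assumes P: "P \<in> carrier_mat n n" and "det P \<noteq> 0"
  obtains Q where "Q \<in> carrier_mat n n" "P * Q = 1\<^sub>m n" "Q * P = 1\<^sub>m n"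
  using det_non_zero_imp_unit[OF assms, of "()"] unfolding Units_def ring_mat_def by auto

section \<open>Invariant subspaces\<close>

lemma subspace_vecI:
  fixes W :: "complex vec set"
  assumes "W \<subseteq> carrier_vec n" "0\<^sub>v n \<in> W" "\<And>v w. \<lbrakk>v \<in> W; w \<in> W\<rbrakk> \<Longrightarrow> v + w \<in> W"
    and "\<And>c v. v \<in> W \<Longrightarrow> c \<cdot>\<^sub>v v \<in> W"
  shows "VectorSpace.subspace class_ring W (module_vec TYPE(complex) n)"
  unfolding VectorSpace.subspace_def submodule_def
  using assms vec_vs vec_module by (auto simp: module_vec_simps)

lemma subspace_vecD:
  fixes W :: "complex vec set"
  assumes "VectorSpace.subspace class_ring W (module_vec TYPE(complex) n)"
  shows "W \<subseteq> carrier_vec n" "0\<^sub>v n \<in> W" "\<And>v w. \<lbrakk>v \<in> W; w \<in> W\<rbrakk> \<Longrightarrow> v + w \<in> W"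
    and "\<And>c v. v \<in> W \<Longrightarrow> c \<cdot>\<^sub>v v \<in> W"
  using assms unfolding VectorSpace.subspace_def submodule_def
  by (auto simp: module_vec_simps)

lemma matrix_repD:
  assumes "matrix_rep G n R"
  shows "g \<in> carrier G \<Longrightarrow> R g \<in> carrier_mat n n" "R \<one>\<^bsub>G\<^esub> = 1\<^sub>m n"
    and "\<lbrakk>g \<in> carrier G; h \<in> carrier G\<rbrakk> \<Longrightarrow> R (g \<otimes>\<^bsub>G\<^esub> h) = R g * R h"
  using assms unfolding matrix_rep_def by auto

lemma irreducible_matrix_repD:
  assumes "irreducible_matrix_rep G n R"
  shows "matrix_rep G n R" "0 < n"
    and "\<lbrakk>VectorSpace.subspace class_ring W (module_vec TYPE(complex) n);
          \<And>g w. \<lbrakk>g \<in> carrier G; w \<in> W\<rbrakk> \<Longrightarrow> R g *\<^sub>v w \<in> W\<rbrakk> \<Longrightarrow> W = {0\<^sub>v n} \<or> W = carrier_vec n"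
  using assms unfolding irreducible_matrix_rep_def by auto

lemma rep_character_trace:
  assumes "matrix_rep G n R" "g \<in> carrier G"
  shows "rep_character G n R g = mat_trace (R g)"
  using assms matrix_repD(1)[OF assms] by (simp add: rep_character_def mat_trace_def)

section \<open>Schur's lemma\<close>

text \<open>\<open>T\<close> maps the space of \<open>S\<close> to the space of \<open>R\<close>.
  The target is listed first, so that \<open>n\<close> and \<open>m\<close> appear in the order of
  the shape of \<open>T\<close>.\<close>

definition intertwines ::
    "('a, 'b) monoid_scheme \<Rightarrow> nat \<Rightarrow> ('a \<Rightarrow> complex mat) \<Rightarrow> nat \<Rightarrow> ('a \<Rightarrow> complex mat)
      \<Rightarrow> complex mat \<Rightarrow> bool" where
  "intertwines G n R m S T \<longleftrightarrow>
     T \<in> carrier_mat n m \<and> (\<forall>g\<in>carrier G. R g * T = T * S g)"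

text \<open>The kernel of \<open>T\<close> is invariant under \<open>S\<close>, so irreducibility of
  \<open>S\<close> leaves only zero or everything, and the latter would make \<open>T\<close>
  zero.\<close>

lemma schur_injective:
  assumes R: "matrix_rep G n R" and S: "irreducible_matrix_rep G m S"
    and T: "intertwines G n R m S T" "T \<noteq> 0\<^sub>m n m"
    and v: "v \<in> carrier_vec m" "T *\<^sub>v v = 0\<^sub>v n"
  shows "v = 0\<^sub>v m"
proof -
  note S' = irreducible_matrix_repD[OF S]
  have Tc: "T \<in> carrier_mat n m" and Ti: "\<And>g. g \<in> carrier G \<Longrightarrow> R g * T = T * S g"
    using T unfolding intertwines_def by auto
  let ?W = "{v \<in> carrier_vec m. T *\<^sub>v v = 0\<^sub>v n}"
  have "VectorSpace.subspace class_ring ?W (module_vec TYPE(complex) m)"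
    using Tc by (intro subspace_vecI) (auto simp: mult_add_distrib_mat_vec mult_mat_vec)
  moreover have "S g *\<^sub>v w \<in> ?W" if g: "g \<in> carrier G" and w: "w \<in> ?W" for g w
  proof -
    note cs = matrix_repD(1)[OF R g] matrix_repD(1)[OF S'(1) g]
    have "T *\<^sub>v (S g *\<^sub>v w) = R g *\<^sub>v (T *\<^sub>v w)"
      using assoc_mult_mat_vec[OF cs(1) Tc, of w] assoc_mult_mat_vec[OF Tc cs(2), of w] Ti[OF g] w
      by simp
    then show ?thesis using cs w by auto
  qed
  ultimately have "?W = {0\<^sub>v m} \<or> ?W = carrier_vec m" by (rule S'(3))
  moreover have "?W \<noteq> carrier_vec m"
    using mat_zero_if_vanishes[OF Tc] T(2) by auto
  ultimately show ?thesis using v by blast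
qed

text \<open>Dual to \<open>schur_injective\<close>: the image of \<open>T\<close> is invariant under
  \<open>R\<close> and contains a nonzero vector, so irreducibility of \<open>R\<close> makes it the
  whole space.\<close>

lemma schur_surjective:
  assumes R: "irreducible_matrix_rep G n R" and S: "matrix_rep G m S"
    and T: "intertwines G n R m S T" "T \<noteq> 0\<^sub>m n m" and v: "v \<in> carrier_vec n"
  obtains u where "u \<in> carrier_vec m" "T *\<^sub>v u = v"
proof -
  note R' = irreducible_matrix_repD[OF R]
  have Tc: "T \<in> carrier_mat n m" and Ti: "\<And>g. g \<in> carrier G \<Longrightarrow> R g * T = T * S g"
    using T unfolding intertwines_def by auto
  let ?W = "(*\<^sub>v) T ` carrier_vec m"
  have "VectorSpace.subspace class_ring ?W (module_vec TYPE(complex) n)"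
  proof (rule subspace_vecI)
    show "0\<^sub>v n \<in> ?W" using Tc by (intro image_eqI[of _ _ "0\<^sub>v m"]) auto
    show "v + w \<in> ?W" if "v \<in> ?W" "w \<in> ?W" for v w
    proof -
      obtain v' w' where "v = T *\<^sub>v v'" "w = T *\<^sub>v w'" "v' \<in> carrier_vec m" "w' \<in> carrier_vec m"
        using \<open>v \<in> ?W\<close> \<open>w \<in> ?W\<close> by auto
      then show ?thesis
        using Tc by (intro image_eqI[of _ _ "v' + w'"]) (auto simp: mult_add_distrib_mat_vec)
    qed
    show "c \<cdot>\<^sub>v v \<in> ?W" if "v \<in> ?W" for c v
    proof -
      obtain v' where "v = T *\<^sub>v v'" "v' \<in> carrier_vec m"
        using \<open>v \<in> ?W\<close> by auto
      then show ?thesis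
        using Tc by (intro image_eqI[of _ _ "c \<cdot>\<^sub>v v'"]) (auto simp: mult_mat_vec)
    qed
  qed (use Tc in auto)
  moreover have "R g *\<^sub>v w \<in> ?W" if g: "g \<in> carrier G" and w: "w \<in> ?W" for g w
  proof -
    note cs = matrix_repD(1)[OF S g] matrix_repD(1)[OF R'(1) g]
    obtain u where u: "w = T *\<^sub>v u" "u \<in> carrier_vec m" using w by auto
    then have "R g *\<^sub>v w = T *\<^sub>v (S g *\<^sub>v u)"
      using assoc_mult_mat_vec[OF cs(2) Tc, of u] assoc_mult_mat_vec[OF Tc cs(1), of u] Ti[OF g]
      by simp
    then show ?thesis using cs u by auto
  qed
  ultimately have "?W = {0\<^sub>v n} \<or> ?W = carrier_vec n" by (rule R'(3))
  moreover have "?W \<noteq> {0\<^sub>v n}"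
    using mat_zero_if_vanishes[OF Tc] T(2) by blast
  ultimately have "v \<in> ?W" using v by simp
  then show ?thesis using that by auto
qed

text \<open>A nonzero \<open>T\<close> is invertible: surjectivity supplies a right inverse, and
  injectivity makes it a left inverse as well. Conjugation by \<open>T\<close> then preserves
  traces.\<close>

lemma schur_isomorphism:
  assumes R: "irreducible_matrix_rep G n R" and S: "irreducible_matrix_rep G m S"
    and T: "intertwines G n R m S T" "T \<noteq> 0\<^sub>m n m"
  shows "rep_character G n R = rep_character G m S"
proof -
  note R' = irreducible_matrix_repD[OF R] and S' = irreducible_matrix_repD[OF S]
  have Tc: "T \<in> carrier_mat n m" and Ti: "\<And>g. g \<in> carrier G \<Longrightarrow> R g * T = T * S g"
    using T unfolding intertwines_def by auto
  have "\<exists>u. \<forall>i<n. u i \<in> carrier_vec m \<and> T *\<^sub>v u i = unit_vec n i"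
  proof -
    have "\<forall>i. \<exists>u. i < n \<longrightarrow> u \<in> carrier_vec m \<and> T *\<^sub>v u = unit_vec n i"
      using schur_surjective[OF R S'(1) T] by (metis unit_vec_carrier)
    then show ?thesis by metis
  qed
  \<comment> \<open>The chosen preimages of the unit vectors become the columns of \<open>U\<close>,
    whence \<open>T * U\<close> is the identity.\<close>
  then obtain u where u: "\<And>i. i < n \<Longrightarrow> u i \<in> carrier_vec m"
      "\<And>i. i < n \<Longrightarrow> T *\<^sub>v u i = unit_vec n i" by blast
  define U where "U = mat m n (\<lambda>(i, j). u j $ i)"
  have Uc: "U \<in> carrier_mat m n" by (simp add: U_def)
  have Ucol: "col U j = u j" if "j < n" for j
    using u(1)[OF that] that by (intro eq_vecI) (auto simp: U_def)
  have TU: "T * U = 1\<^sub>m n"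
  proof (rule eq_matI)
    fix i j assume "i < dim_row (1\<^sub>m n :: complex mat)" "j < dim_col (1\<^sub>m n :: complex mat)"
    then have ij: "i < n" "j < n" by auto
    then have "(T * U) $$ (i, j) = (T *\<^sub>v u j) $ i"
      using Tc Uc by (simp add: Ucol)
    also have "\<dots> = 1\<^sub>m n $$ (i, j)" using u(2) ij by simp
    finally show "(T * U) $$ (i, j) = 1\<^sub>m n $$ (i, j)" .
  qed (use Tc Uc in auto)
  \<comment> \<open>\<open>T\<close> annihilates every value of this difference because
    \<open>T * U\<close> is the identity, and \<open>T\<close> is injective.\<close>
  have "U * T - 1\<^sub>m m = 0\<^sub>m m m"
  proof (rule mat_zero_if_vanishes)
    fix v :: "complex vec" assume v: "v \<in> carrier_vec m"
    show "(U * T - 1\<^sub>m m) *\<^sub>v v = 0\<^sub>v m"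
    proof (rule schur_injective[OF R'(1) S T])
      have "T * (U * T - 1\<^sub>m m) = T * U * T - T"
        using Tc mult_minus_distrib_mat[OF Tc mult_carrier_mat[OF Uc Tc] one_carrier_mat]
          assoc_mult_mat[OF Tc Uc Tc] by simp
      also have "\<dots> = 0\<^sub>m n m" using TU Tc by simp
      finally have "T * (U * T - 1\<^sub>m m) = 0\<^sub>m n m" .
      moreover have "U * T - 1\<^sub>m m \<in> carrier_mat m m" using Tc Uc by auto
      ultimately show "T *\<^sub>v ((U * T - 1\<^sub>m m) *\<^sub>v v) = 0\<^sub>v n"
        using assoc_mult_mat_vec[OF Tc _ v, symmetric] v by (simp add: zero_mat_mult_vec)
    qed (use Tc Uc v in \<open>auto intro!: mult_mat_vec_carrier[of _ m m]\<close>)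
  qed (use Tc Uc in auto)
  then have UT: "U * T = 1\<^sub>m m"
    by (rule eq_mat_if_minus_zero[rotated 2]) (use Tc Uc in auto)
  show ?thesis
  proof
    fix g
    show "rep_character G n R g = rep_character G m S g"
    proof (cases "g \<in> carrier G")
      case True
      note cs = matrix_repD(1)[OF R'(1) True] matrix_repD(1)[OF S'(1) True]
      have "T * S g * U = R g"
        using cs TU assoc_mult_mat[OF cs(1) Tc Uc] by (simp flip: Ti[OF True])
      then have "mat_trace (R g) = mat_trace (S g)"
        using mat_trace_similar[OF cs(2) Tc Uc UT] by simp
      then show ?thesis using True rep_character_trace R'(1) S'(1) by metis
    qed (simp add: rep_character_def)
  qed
qed

text \<open>Over the complex numbers \<open>T\<close> has an eigenvalue \<open>c\<close>. The matrix
  \<open>char_matrix T c\<close>, which is \<open>T\<close> minus \<open>c\<close> times the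
  identity, is again an intertwiner but has a nonzero kernel, so \<open>schur_injective\<close>
  forces it to vanish.\<close>

lemma schur_scalar:
  assumes R: "irreducible_matrix_rep G n R" and T: "intertwines G n R n R T"
  obtains c where "T = c \<cdot>\<^sub>m 1\<^sub>m n"
proof -
  note R' = irreducible_matrix_repD[OF R]
  have Tc: "T \<in> carrier_mat n n" and Ti: "\<And>g. g \<in> carrier G \<Longrightarrow> R g * T = T * R g"
    using T unfolding intertwines_def by auto
  obtain c where "eigenvalue T c"
    using spectrum_non_empty[OF Tc R'(2)] unfolding spectrum_def by auto
  then obtain v where v: "v \<in> carrier_vec n" "v \<noteq> 0\<^sub>v n" "char_matrix T c *\<^sub>v v = 0\<^sub>v n"
    unfolding eigenvalue_def eigenvector_char_matrix[OF Tc] by auto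
  have Cc: "char_matrix T c \<in> carrier_mat n n" using Tc by simp
  have "intertwines G n R n R (char_matrix T c)"
    unfolding intertwines_def
  proof (intro conjI ballI Cc)
    fix g assume g: "g \<in> carrier G"
    note cs = matrix_repD(1)[OF R'(1) g]
    have "R g * char_matrix T c = R g * T + (- c) \<cdot>\<^sub>m R g"
      using cs Tc mult_smult_distrib[OF cs one_carrier_mat, of "- c"]
      by (simp add: char_matrix_def mult_add_distrib_mat[OF cs Tc])
    also have "\<dots> = T * R g + (- c) \<cdot>\<^sub>m R g" using Ti[OF g] by simp
    also have "\<dots> = char_matrix T c * R g"
      using cs Tc mult_smult_assoc_mat[OF one_carrier_mat cs, of "- c"]
      by (simp add: char_matrix_def add_mult_distrib_mat[OF Tc _ cs])
    finally show "R g * char_matrix T c = char_matrix T c * R g" .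
  qed
  then have z: "char_matrix T c = 0\<^sub>m n n"
    using schur_injective[OF R'(1) R] v by blast
  have "T = c \<cdot>\<^sub>m 1\<^sub>m n"
  proof (rule eq_matI)
    fix i j assume "i < dim_row (c \<cdot>\<^sub>m 1\<^sub>m n)" "j < dim_col (c \<cdot>\<^sub>m 1\<^sub>m n)"
    then have "char_matrix T c $$ (i, j) = T $$ (i, j) + (- c) * 1\<^sub>m n $$ (i, j)" "i < n" "j < n"
      using Tc by (auto simp: char_matrix_def)
    with z show "T $$ (i, j) = (c \<cdot>\<^sub>m 1\<^sub>m n) $$ (i, j)" by simp
  qed (use Tc in auto)
  then show ?thesis using that by blast
qed

section \<open>Schur orthogonality\<close>

locale finite_group = group G for G (structure) +
  assumes finite_carrier: "finite (carrier G)"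
begin

lemma card_nonzero: "of_nat (card (carrier G)) \<noteq> (0 :: complex)"
  using finite_carrier one_closed by auto

lemma sum_left_translate:
  assumes "h \<in> carrier G"
  shows "(\<Sum>g\<in>carrier G. f (h \<otimes> g)) = (\<Sum>g\<in>carrier G. f g)"
  by (rule sum.reindex_bij_witness[of _ "\<lambda>g. inv h \<otimes> g" "\<lambda>g. h \<otimes> g"])
    (use assms in \<open>auto simp: m_assoc[symmetric]\<close>)

text \<open>This is the sum over \<open>g\<close> of \<open>R g * E * S (inv g)\<close>, where
  \<open>E\<close> is the matrix unit with its 1 at position \<open>(j, k)\<close>. Its entries are
  exactly the sums in the orthogonality relations.\<close>

definition averaged ::
    "nat \<Rightarrow> ('a \<Rightarrow> complex mat) \<Rightarrow> nat \<Rightarrow> ('a \<Rightarrow> complex mat) \<Rightarrow> nat \<Rightarrow> nat \<Rightarrow> complex mat" where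
  "averaged n R m S j k =
     mat n m (\<lambda>(i, l). \<Sum>g\<in>carrier G. R g $$ (i, j) * S (inv g) $$ (k, l))"

lemma averaged_intertwines:
  assumes R: "matrix_rep G n R" and S: "matrix_rep G m S" and "j < n" "k < m"
  shows "intertwines G n R m S (averaged n R m S j k)"
  unfolding intertwines_def
proof (intro conjI ballI)
  let ?T = "averaged n R m S j k"
  show T: "?T \<in> carrier_mat n m" by (simp add: averaged_def)
  note Rc = matrix_repD(1)[OF R] and Sc = matrix_repD(1)[OF S]
  fix h assume h: "h \<in> carrier G"
  show "R h * ?T = ?T * S h"
  proof (rule eq_matI)
    fix i l assume "i < dim_row (?T * S h)" "l < dim_col (?T * S h)"
    then have i: "i < n" and l: "l < m" using T Sc[OF h] by auto
    have "(R h * ?T) $$ (i, l)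
        = (\<Sum>p<n. R h $$ (i, p) * (\<Sum>g\<in>carrier G. R g $$ (p, j) * S (inv g) $$ (k, l)))"
      using mult_mat_entry[OF Rc[OF h] T i l] l by (simp add: averaged_def)
    also have "\<dots> = (\<Sum>g\<in>carrier G. (\<Sum>p<n. R h $$ (i, p) * R g $$ (p, j)) * S (inv g) $$ (k, l))"
      by (simp add: sum_distrib_left sum_distrib_right mult.assoc) (rule sum.swap)
    \<comment> \<open>Writing \<open>inv g\<close> as \<open>inv (h \<otimes> g) \<otimes> h\<close>
      makes the summand a function of \<open>h \<otimes> g\<close> alone, so the sum may be
      translated by \<open>h\<close>.\<close>
    also have "\<dots> = (\<Sum>g\<in>carrier G. R (h \<otimes> g) $$ (i, j) * S (inv (h \<otimes> g) \<otimes> h) $$ (k, l))"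
    proof (rule sum.cong[OF refl])
      fix g assume g: "g \<in> carrier G"
      have "inv (h \<otimes> g) \<otimes> h = inv g"
        using g h by (simp add: inv_mult_group m_assoc)
      then show "(\<Sum>p<n. R h $$ (i, p) * R g $$ (p, j)) * S (inv g) $$ (k, l)
          = R (h \<otimes> g) $$ (i, j) * S (inv (h \<otimes> g) \<otimes> h) $$ (k, l)"
        using mult_mat_entry[OF Rc[OF h] Rc[OF g] i \<open>j < n\<close>] matrix_repD(3)[OF R h g] by simp
    qed
    also have "\<dots> = (\<Sum>g\<in>carrier G. R g $$ (i, j) * S (inv g \<otimes> h) $$ (k, l))"
      by (rule sum_left_translate[OF h])
    also have "\<dots> = (\<Sum>g\<in>carrier G. R g $$ (i, j) * (\<Sum>p<m. S (inv g) $$ (k, p) * S h $$ (p, l)))"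
      using h mult_mat_entry[OF Sc Sc[OF h] \<open>k < m\<close> l] matrix_repD(3)[OF S _ h]
      by (intro sum.cong) auto
    also have "\<dots> = (\<Sum>p<m. (\<Sum>g\<in>carrier G. R g $$ (i, j) * S (inv g) $$ (k, p)) * S h $$ (p, l))"
      by (simp add: sum_distrib_left sum_distrib_right mult.assoc) (rule sum.swap)
    also have "\<dots> = (?T * S h) $$ (i, l)"
      using mult_mat_entry[OF T Sc[OF h] i l] i by (simp add: averaged_def)
    finally show "(R h * ?T) $$ (i, l) = (?T * S h) $$ (i, l)" .
  qed (use T Rc[OF h] Sc[OF h] in auto)
qed

text \<open>The sum is an entry of an averaged intertwiner, and a nonzero intertwiner would make the
  two characters equal.\<close>

lemma schur_orthogonality_distinct:
  assumes R: "irreducible_matrix_rep G n R" and S: "irreducible_matrix_rep G m S"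
    and "rep_character G n R \<noteq> rep_character G m S" and "i < n" "j < n" "k < m" "l < m"
  shows "(\<Sum>g\<in>carrier G. R g $$ (i, j) * S (inv g) $$ (k, l)) = 0"
proof -
  have "averaged n R m S j k = 0\<^sub>m n m"
    using averaged_intertwines[of n R m S j k] schur_isomorphism[OF R S] assms
      irreducible_matrix_repD(1) by blast
  then have "averaged n R m S j k $$ (i, l) = 0" using assms by simp
  then show ?thesis using assms by (simp add: averaged_def)
qed

text \<open>The averaged intertwiner is a scalar matrix. Its scalar is found by taking the trace,
  where \<open>R (inv g) * R g\<close> collapses to the identity.\<close>

lemma schur_orthogonality_same:
  assumes R: "irreducible_matrix_rep G n R" and "i < n" "j < n" "k < n" "l < n"
  shows "(\<Sum>g\<in>carrier G. R g $$ (i, j) * R (inv g) $$ (k, l))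
    = (if i = l \<and> j = k then of_nat (card (carrier G)) / of_nat n else 0)"
proof -
  note R' = irreducible_matrix_repD[OF R]
  note Rc = matrix_repD(1)[OF R'(1)]
  obtain c where c: "averaged n R n R j k = c \<cdot>\<^sub>m 1\<^sub>m n"
    using averaged_intertwines[OF R'(1) R'(1)] schur_scalar[OF R] assms by metis
  have entry: "(\<Sum>g\<in>carrier G. R g $$ (i, j) * R (inv g) $$ (k, l)) = (if i = l then c else 0)"
    if "i < n" "l < n" for i l
  proof -
    have "averaged n R n R j k $$ (i, l) = (if i = l then c else 0)" using c that by simp
    then show ?thesis using that by (simp add: averaged_def)
  qed
  \<comment> \<open>The trace of the scalar matrix, summed over the diagonal
    \<open>i = l\<close>.\<close>
  have "of_nat n * c = (\<Sum>i<n. \<Sum>g\<in>carrier G. R g $$ (i, j) * R (inv g) $$ (k, i))"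
    using entry by simp
  also have "\<dots> = (\<Sum>g\<in>carrier G. (\<Sum>i<n. R (inv g) $$ (k, i) * R g $$ (i, j)))"
    by (subst sum.swap) (simp add: mult.commute)
  also have "\<dots> = (\<Sum>g\<in>carrier G. (1\<^sub>m n :: complex mat) $$ (k, j))"
  proof (rule sum.cong[OF refl])
    fix g assume g: "g \<in> carrier G"
    have "R (inv g) * R g = 1\<^sub>m n"
      using g matrix_repD(2)[OF R'(1)] matrix_repD(3)[OF R'(1) inv_closed[OF g] g] by simp
    then show "(\<Sum>i<n. R (inv g) $$ (k, i) * R g $$ (i, j)) = (1\<^sub>m n :: complex mat) $$ (k, j)"
      using mult_mat_entry[OF Rc[OF inv_closed[OF g]] Rc[OF g] \<open>k < n\<close> \<open>j < n\<close>] by simp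
  qed
  also have "\<dots> = (if j = k then of_nat (card (carrier G)) else 0)"
    using assms by simp
  finally have "c = (if j = k then of_nat (card (carrier G)) / of_nat n else 0)"
    using R'(2) by (simp add: field_simps split: if_splits)
  then show ?thesis using entry[of i l] assms by simp
qed

text \<open>The value at \<open>inv g\<close> stands where the complex conjugate of
  \<open>\<psi> g\<close> usually appears. Since characters are compared as functions, equal ones
  can be expanded with one and the same representation \<open>R\<close>.\<close>

lemma character_orthogonality:
  assumes "\<phi> \<in> irreducible_characters G" "\<psi> \<in> irreducible_characters G"
  shows "(\<Sum>g\<in>carrier G. \<phi> g * \<psi> (inv g)) = (if \<phi> = \<psi> then of_nat (card (carrier G)) else 0)"
proof -
  obtain n R where R: "irreducible_matrix_rep G n R" "\<phi> = rep_character G n R"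
    using assms(1) unfolding irreducible_characters_def by blast
  have expand: "(\<Sum>g\<in>carrier G. \<phi> g * rep_character G m S (inv g))
      = (\<Sum>i<n. \<Sum>k<m. \<Sum>g\<in>carrier G. R g $$ (i, i) * S (inv g) $$ (k, k))" for m S
  proof -
    have "(\<Sum>g\<in>carrier G. \<phi> g * rep_character G m S (inv g))
        = (\<Sum>g\<in>carrier G. \<Sum>i<n. \<Sum>k<m. R g $$ (i, i) * S (inv g) $$ (k, k))"
      using R(2) by (simp add: rep_character_def sum_product)
    also have "\<dots> = (\<Sum>i<n. \<Sum>g\<in>carrier G. \<Sum>k<m. R g $$ (i, i) * S (inv g) $$ (k, k))"
      by (rule sum.swap)
    also have "\<dots> = (\<Sum>i<n. \<Sum>k<m. \<Sum>g\<in>carrier G. R g $$ (i, i) * S (inv g) $$ (k, k))"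
      by (intro sum.cong refl sum.swap)
    finally show ?thesis .
  qed
  show ?thesis
  proof (cases "\<phi> = \<psi>")
    case True
    have "(\<Sum>g\<in>carrier G. \<phi> g * \<phi> (inv g))
        = (\<Sum>i<n. \<Sum>k<n. if i = k then of_nat (card (carrier G)) / of_nat n else 0)"
      using expand[of n R] schur_orthogonality_same[OF R(1)] R(2) by simp
    also have "\<dots> = of_nat (card (carrier G))"
      using irreducible_matrix_repD(2)[OF R(1)] by simp
    finally show ?thesis using True by simp
  next
    case False
    obtain m S where S: "irreducible_matrix_rep G m S" "\<psi> = rep_character G m S"
      using assms(2) unfolding irreducible_characters_def by blast
    then show ?thesis
      using False expand[of m S] schur_orthogonality_distinct[OF R(1) S(1)] R(2) by simp
  qed
qed

end

section \<open>Decomposition of characters\<close>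

lemma sum_lessThan_add:
  fixes f :: "nat \<Rightarrow> 'b :: comm_monoid_add"
  shows "(\<Sum>i<k + m. f i) = (\<Sum>i<k. f i) + (\<Sum>i<m. f (k + i))"
  by (induction m) (simp_all add: add.assoc)

section \<open>Bases adapted to an invariant subspace and block triangular form\<close>

lemma mult_mat_vec_mem_subspace:
  fixes W :: "complex vec set"
  assumes W: "VectorSpace.subspace class_ring W (module_vec TYPE(complex) n)"
    and P: "P \<in> carrier_mat n m" "\<And>i. i < m \<Longrightarrow> col P i \<in> W" and x: "x \<in> carrier_vec m"
  shows "P *\<^sub>v x \<in> W"
proof -
  note W' = subspace_vecD[OF W]
  \<comment> \<open>Induction on truncations of \<open>x\<close> to its first \<open>t\<close>
    coordinates; each step adds one multiple of a column of \<open>P\<close>.\<close>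
  have "P *\<^sub>v vec m (\<lambda>i. if i < t then x $ i else 0) \<in> W" if "t \<le> m" for t
    using that
  proof (induction t)
    case 0
    have "P *\<^sub>v vec m (\<lambda>i. if i < 0 then x $ i else 0) = 0\<^sub>v n"
      using P(1) by (intro eq_vecI) (auto simp: scalar_prod_def)
    then show ?case using W'(2) by simp
  next
    case (Suc t)
    have "vec m (\<lambda>i. if i < Suc t then x $ i else 0)
        = vec m (\<lambda>i. if i < t then x $ i else 0) + x $ t \<cdot>\<^sub>v unit_vec m t"
      using Suc.prems by (intro eq_vecI) (auto simp: less_Suc_eq)
    then have "P *\<^sub>v vec m (\<lambda>i. if i < Suc t then x $ i else 0)
        = P *\<^sub>v vec m (\<lambda>i. if i < t then x $ i else 0) + x $ t \<cdot>\<^sub>v col P t"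
      using Suc.prems P(1)
      by (simp add: mult_add_distrib_mat_vec[of P n m] mult_mat_vec[of P n m] mat_mult_unit_vec)
    then show ?case using Suc P(2) W'(3,4) by simp
  qed
  moreover have "vec m (\<lambda>i. if i < m then x $ i else 0) = x"
    using x by (intro eq_vecI) auto
  ultimately show ?thesis by (metis order_refl)
qed

text \<open>The Steinitz exchange step in coordinates: the first \<open>k\<close> basis vectors are
  kept and \<open>u\<close> becomes the next one. It drives the maximality argument in
  \<open>adapted_basis\<close>.\<close>

lemma exchange_matrix:
  fixes u :: "complex vec"
  assumes u: "u \<in> carrier_vec n" and j: "k \<le> j" "j < n" "u $ j \<noteq> 0"
  obtains E where "E \<in> carrier_mat n n" "det E \<noteq> 0" "\<And>i. i < k \<Longrightarrow> col E i = unit_vec n i"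
    "col E k = u"
proof -
  define E :: "complex mat" where "E = mat n n (\<lambda>(i, c). if c = k then u $ i
      else if c = j then (if i = k then 1 else 0) else if i = c then 1 else 0)"
  \<comment> \<open>the standard basis with \<open>e\<^sub>j\<close> replaced by \<open>u\<close>, moved to position \<open>k\<close>\<close>
  have E: "E \<in> carrier_mat n n" by (simp add: E_def)
  have "v = 0\<^sub>v n" if v: "v \<in> carrier_vec n" "E *\<^sub>v v = 0\<^sub>v n" for v
  proof -
    have entry: "u $ i * v $ k + (if j \<noteq> k \<and> i = k then v $ j else 0)
        + (if i \<noteq> k \<and> i \<noteq> j then v $ i else 0) = 0" if i: "i < n" for i
    proof -
      have "(E *\<^sub>v v) $ i = (\<Sum>c<n. E $$ (i, c) * v $ c)"
        using mult_mat_vec_entry[OF E v(1) i] .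
      also have "\<dots> = (\<Sum>c<n. (if c = k then u $ i * v $ k else 0)
          + (if c = j then if j \<noteq> k \<and> i = k then v $ j else 0 else 0)
          + (if c = i then if i \<noteq> k \<and> i \<noteq> j then v $ i else 0 else 0))"
        using i by (intro sum.cong) (auto simp: E_def)
      also have "\<dots> = u $ i * v $ k + (if j \<noteq> k \<and> i = k then v $ j else 0)
          + (if i \<noteq> k \<and> i \<noteq> j then v $ i else 0)"
        using i j by (simp add: sum.distrib)
      finally show ?thesis using v(2) i by simp
    qed
    \<comment> \<open>Row \<open>j\<close> of the system reads \<open>u $ j * v $ k = 0\<close>. Row
      \<open>k\<close> then gives \<open>v $ j = 0\<close>, and the remaining rows give the other
      coordinates.\<close>
    have vk: "v $ k = 0" using entry[of j] j by (auto split: if_splits)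
    have "v $ i = 0" if "i < n" for i
      using entry[OF that] entry[of k] vk j by (auto split: if_splits)
    then show ?thesis using v(1) by (intro eq_vecI) auto
  qed
  then have "det E \<noteq> 0" using det_0_iff_vec_prod_zero[OF E] by blast
  moreover have "col E i = unit_vec n i" if "i < k" for i
    using that j by (intro eq_vecI) (auto simp: E_def)
  moreover have "col E k = u"
    using u j by (intro eq_vecI) (auto simp: E_def)
  ultimately show ?thesis using that E by blast
qed

text \<open>Take an invertible \<open>P\<close> with as many leading columns in \<open>W\<close> as
  possible. A vector of \<open>W\<close> with a nonzero later coordinate could be exchanged in,
  contradicting maximality, so these columns span \<open>W\<close>.\<close>

lemma adapted_basis:
  fixes W :: "complex vec set"
  assumes W: "VectorSpace.subspace class_ring W (module_vec TYPE(complex) n)"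
    and "W \<noteq> {0\<^sub>v n}" "W \<noteq> carrier_vec n"
  obtains k P Q where "0 < k" "k < n" "P \<in> carrier_mat n n" "Q \<in> carrier_mat n n"
    "P * Q = 1\<^sub>m n" "Q * P = 1\<^sub>m n" "\<And>i. i < k \<Longrightarrow> col P i \<in> W"
    "\<And>w i. \<lbrakk>w \<in> W; k \<le> i; i < n\<rbrakk> \<Longrightarrow> (Q *\<^sub>v w) $ i = 0"
proof -
  note W' = subspace_vecD[OF W]
  \<comment> \<open>The bound \<open>k \<le> n\<close> keeps \<open>K\<close> finite, so that
    \<open>Max K\<close> is meaningful; the identity matrix shows that 0 belongs to it.\<close>
  define K where "K = {k. k \<le> n \<and> (\<exists>P\<in>carrier_mat n n. det P \<noteq> 0 \<and> (\<forall>i<k. col P i \<in> W))}"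
  define k where "k = Max K"
  have fin: "finite K" unfolding K_def by simp
  have "0 \<in> K" unfolding K_def by (auto intro!: bexI[of _ "1\<^sub>m n"])
  then have "k \<in> K" unfolding k_def using fin by (intro Max_in) auto
  then obtain P where P: "P \<in> carrier_mat n n" "det P \<noteq> 0" "\<And>i. i < k \<Longrightarrow> col P i \<in> W"
    and kn: "k \<le> n" unfolding K_def by blast
  obtain Q where Q: "Q \<in> carrier_mat n n" "P * Q = 1\<^sub>m n" "Q * P = 1\<^sub>m n"
    using inverse_mat_if_det_nonzero[OF P(1,2)] .
  have PQ: "P *\<^sub>v (Q *\<^sub>v w) = w" if "w \<in> carrier_vec n" for w
    using assoc_mult_mat_vec[OF P(1) Q(1) that] Q(2) that by simp
  have coord: "(Q *\<^sub>v w) $ j = 0" if w: "w \<in> W" and j: "k \<le> j" "j < n" for w j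
  proof (rule ccontr)
    have wc: "w \<in> carrier_vec n" using w W'(1) by auto
    then have "Q *\<^sub>v w \<in> carrier_vec n" using Q(1) by simp
    moreover assume "(Q *\<^sub>v w) $ j \<noteq> 0"
    ultimately obtain E where E: "E \<in> carrier_mat n n" "det E \<noteq> 0"
      "\<And>i. i < k \<Longrightarrow> col E i = unit_vec n i" "col E k = Q *\<^sub>v w"
      using exchange_matrix[of "Q *\<^sub>v w"] j by metis
    \<comment> \<open>Multiplying by \<open>E\<close> preserves the first \<open>k\<close> columns
      of \<open>P\<close> and turns column \<open>k\<close> into \<open>P\<close> applied to
      \<open>Q *\<^sub>v w\<close>, which is \<open>w\<close>.\<close>
    have "col (P * E) i \<in> W" if "i < Suc k" for i
    proof -
      have col: "col (P * E) i = P *\<^sub>v col E i"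
        using P(1) E(1) that j by (intro col_mult2[of _ n n _ n]) auto
      show ?thesis
      proof (cases "i = k")
        case True
        then show ?thesis using col E(4) PQ[OF wc] w by simp
      next
        case False
        then have "i < k" using that by simp
        then show ?thesis using col E(3) P(3) mat_mult_unit_vec[OF P(1)] j by simp
      qed
    qed
    moreover have "det (P * E) \<noteq> 0" using det_mult[OF P(1) E(1)] P(2) E(2) by simp
    ultimately have "Suc k \<in> K" unfolding K_def using j P(1) E(1) by auto
    then have "Suc k \<le> k" using Max_ge[OF fin] unfolding k_def by blast
    then show False by simp
  qed
  have "k \<noteq> 0"
  proof
    assume "k = 0"
    have "w = 0\<^sub>v n" if w: "w \<in> W" for w
    proof -
      have wc: "w \<in> carrier_vec n" using w W'(1) by auto
      have "Q *\<^sub>v w = 0\<^sub>v n"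
        using Q(1) coord[OF w] \<open>k = 0\<close> by (intro eq_vecI) auto
      moreover have "P *\<^sub>v 0\<^sub>v n = 0\<^sub>v n"
        using P(1) by (intro eq_vecI) auto
      ultimately show ?thesis using PQ[OF wc] by simp
    qed
    then show False using assms(2) W'(2) by blast
  qed
  moreover have "k \<noteq> n"
  proof
    assume "k = n"
    have "v \<in> W" if "v \<in> carrier_vec n" for v
      using mult_mat_vec_mem_subspace[OF W P(1), of "Q *\<^sub>v v"] P(3) \<open>k = n\<close> PQ[OF that] Q(1) that
      by simp
    then show False using assms(3) W'(1) by blast
  qed
  ultimately show ?thesis using that[of k P Q] P(1,3) Q coord kn by auto
qed

text \<open>In a basis adapted to a proper invariant subspace all matrices are block upper
  triangular. The diagonal blocks are the subrepresentation and the quotient representation, and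
  their traces add up.\<close>

lemma reducible_character_splits:
  assumes R: "matrix_rep G n R" and n: "0 < n" and red: "\<not> irreducible_matrix_rep G n R"
  obtains k m R1 R2 where "k < n" "m < n" "matrix_rep G k R1" "matrix_rep G m R2"
    "\<And>g. g \<in> carrier G \<Longrightarrow>
       rep_character G n R g = rep_character G k R1 g + rep_character G m R2 g"
proof -
  note Rc = matrix_repD(1)[OF R]
  obtain W where W: "VectorSpace.subspace class_ring W (module_vec TYPE(complex) n)"
    and inv: "\<And>g w. \<lbrakk>g \<in> carrier G; w \<in> W\<rbrakk> \<Longrightarrow> R g *\<^sub>v w \<in> W"
    and proper: "W \<noteq> {0\<^sub>v n}" "W \<noteq> carrier_vec n"
    using R n red unfolding irreducible_matrix_rep_def by blast
  obtain k P Q where k: "0 < k" "k < n" and P: "P \<in> carrier_mat n n" and Q: "Q \<in> carrier_mat n n"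
    and PQ: "P * Q = 1\<^sub>m n" "Q * P = 1\<^sub>m n" and col: "\<And>i. i < k \<Longrightarrow> col P i \<in> W"
    and coord: "\<And>w i. \<lbrakk>w \<in> W; k \<le> i; i < n\<rbrakk> \<Longrightarrow> (Q *\<^sub>v w) $ i = 0"
    using adapted_basis[OF W proper] by metis
  define m where "m = n - k"
  have nkm: "n = k + m" using k by (simp add: m_def)
  define A where "A g = Q * R g * P" for g
  have Ac: "A g \<in> carrier_mat n n" if "g \<in> carrier G" for g
    using P Q Rc[OF that] by (simp add: A_def)
  have A_one: "A \<one>\<^bsub>G\<^esub> = 1\<^sub>m n"
    using matrix_repD(2)[OF R] Q PQ by (simp add: A_def)
  have A_mult: "A (g \<otimes>\<^bsub>G\<^esub> h) = A g * A h" if g: "g \<in> carrier G" and h: "h \<in> carrier G" for g h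
  proof -
    note gc = Rc[OF g] and hc = Rc[OF h]
    have "A g * A h = Q * R g * (P * (Q * (R h * P)))"
      using P Q gc hc assoc_mult_mat[of "Q * R g" n n P n "A h" n]
      by (simp add: A_def assoc_mult_mat[of Q n n "R h" n P n])
    also have "P * (Q * (R h * P)) = R h * P"
      using P Q hc PQ assoc_mult_mat[of P n n Q n "R h * P" n] by simp
    also have "Q * R g * (R h * P) = Q * (R g * R h) * P"
      using P Q gc hc by (simp add: assoc_mult_mat[of _ n n _ n _ n])
    finally show ?thesis using matrix_repD(3)[OF R g h] by (simp add: A_def)
  qed
  \<comment> \<open>The lower left block vanishes: column \<open>j\<close> of \<open>P\<close> lies
    in \<open>W\<close>, its image under \<open>R g\<close> stays there, and vectors of
    \<open>W\<close> have no coordinates from \<open>k\<close> on.\<close>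
  have A_zero: "A g $$ (i, j) = 0" if g: "g \<in> carrier G" and ij: "k \<le> i" "i < n" "j < k" for g i j
  proof -
    have "R g *\<^sub>v col P j \<in> W" using inv[OF g] col ij by simp
    then have "(Q *\<^sub>v (R g *\<^sub>v col P j)) $ i = 0" using coord ij by simp
    moreover have "Q *\<^sub>v (R g *\<^sub>v col P j) = col (A g) j"
      unfolding A_def using P ij k
        col_mult2[OF mult_carrier_mat[OF Q Rc[OF g]] P, of j]
        assoc_mult_mat_vec[OF Q Rc[OF g], of "col P j"] by (metis col_carrier_vec less_trans)
    ultimately show ?thesis using Ac[OF g] ij k by simp
  qed
  define R1 where "R1 g = mat k k (\<lambda>(i, j). A g $$ (i, j))" for g
  define R2 where "R2 g = mat m m (\<lambda>(i, j). A g $$ (k + i, k + j))" for g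
  \<comment> \<open>The product is split at \<open>k\<close>. By \<open>A_zero\<close>, the second
    sum vanishes in the upper left block and the first sum in the lower right block, so both blocks
    are multiplicative.\<close>
  have entry: "A (g \<otimes>\<^bsub>G\<^esub> h) $$ (i, j)
      = (\<Sum>p<k. A g $$ (i, p) * A h $$ (p, j)) + (\<Sum>p<m. A g $$ (i, k + p) * A h $$ (k + p, j))"
    if "g \<in> carrier G" "h \<in> carrier G" "i < n" "j < n" for g h i j
    unfolding A_mult[OF that(1,2)] mult_mat_entry[OF Ac[OF that(1)] Ac[OF that(2)] that(3,4)]
    by (simp add: nkm sum_lessThan_add)
  have "matrix_rep G k R1"
    unfolding matrix_rep_def
  proof (intro conjI ballI)
    fix g h assume g: "g \<in> carrier G" and h: "h \<in> carrier G"
    have c: "R1 g \<in> carrier_mat k k" "R1 h \<in> carrier_mat k k" by (auto simp: R1_def)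
    show "R1 (g \<otimes>\<^bsub>G\<^esub> h) = R1 g * R1 h"
    proof (rule eq_matI)
      fix i j assume "i < dim_row (R1 g * R1 h)" "j < dim_col (R1 g * R1 h)"
      then have ij: "i < k" "j < k" by (auto simp: R1_def)
      show "R1 (g \<otimes>\<^bsub>G\<^esub> h) $$ (i, j) = (R1 g * R1 h) $$ (i, j)"
        unfolding mult_mat_entry[OF c ij] using entry[OF g h, of i j] A_zero[OF h] ij k
        by (simp add: R1_def nkm)
    qed (auto simp: R1_def)
  qed (use A_one k in \<open>auto simp: R1_def\<close>)
  moreover have "matrix_rep G m R2"
    unfolding matrix_rep_def
  proof (intro conjI ballI)
    fix g h assume g: "g \<in> carrier G" and h: "h \<in> carrier G"
    have c: "R2 g \<in> carrier_mat m m" "R2 h \<in> carrier_mat m m" by (auto simp: R2_def)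
    show "R2 (g \<otimes>\<^bsub>G\<^esub> h) = R2 g * R2 h"
    proof (rule eq_matI)
      fix i j assume "i < dim_row (R2 g * R2 h)" "j < dim_col (R2 g * R2 h)"
      then have ij: "i < m" "j < m" by (auto simp: R2_def)
      show "R2 (g \<otimes>\<^bsub>G\<^esub> h) $$ (i, j) = (R2 g * R2 h) $$ (i, j)"
        unfolding mult_mat_entry[OF c ij] using entry[OF g h, of "k + i" "k + j"] A_zero[OF g] ij
        by (simp add: R2_def nkm)
    qed (auto simp: R2_def)
  qed (use A_one nkm in \<open>auto simp: R2_def\<close>)
  moreover have "rep_character G n R g = rep_character G k R1 g + rep_character G m R2 g"
    if g: "g \<in> carrier G" for g
  proof -
    have "rep_character G n R g = mat_trace (A g)"
      using rep_character_trace[OF R g] mat_trace_similar[OF Rc[OF g] Q P PQ(1)]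
      by (simp add: A_def)
    also have "\<dots> = (\<Sum>i<k. A g $$ (i, i)) + (\<Sum>i<m. A g $$ (k + i, k + i))"
      using Ac[OF g] by (simp add: mat_trace_def nkm sum_lessThan_add)
    finally show ?thesis using g by (simp add: rep_character_def R1_def R2_def)
  qed
  ultimately show ?thesis using that[of k m R1 R2] k m_def by auto
qed

text \<open>Strong induction on the dimension, splitting reducible representations. Only the
  existence of complex coefficients is recorded; orthogonality identifies them later. Finiteness
  matters because a sum over an infinite set would default to 0.\<close>

lemma character_decomposition:
  assumes "matrix_rep G n R" and fin: "finite (irreducible_characters G)"
  shows "\<exists>c. \<forall>g\<in>carrier G. rep_character G n R g = (\<Sum>\<psi>\<in>irreducible_characters G. c \<psi> * \<psi> g)"
  using assms(1)
proof (induction n arbitrary: R rule: less_induct)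
  case (less n)
  consider "n = 0" | "irreducible_matrix_rep G n R" | "0 < n" "\<not> irreducible_matrix_rep G n R"
    by blast
  then show ?case
  proof cases
    case 1
    then show ?thesis by (auto simp: rep_character_def intro!: exI[of _ "\<lambda>_. 0"])
  next
    case 2
    then have "rep_character G n R \<in> irreducible_characters G"
      unfolding irreducible_characters_def by blast
    then show ?thesis
      using fin by (intro exI[of _ "\<lambda>\<psi>. if \<psi> = rep_character G n R then 1 else 0"])
        (simp add: if_distrib[of "\<lambda>x. x * _"] cong: if_cong)
  next
    case 3
    obtain k m R1 R2 where *: "k < n" "m < n" "matrix_rep G k R1" "matrix_rep G m R2"
      "\<And>g. g \<in> carrier G \<Longrightarrow>
         rep_character G n R g = rep_character G k R1 g + rep_character G m R2 g"
      using reducible_character_splits[OF less.prems 3] by metis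
    obtain c d where
      "\<forall>g\<in>carrier G. rep_character G k R1 g = (\<Sum>\<psi>\<in>irreducible_characters G. c \<psi> * \<psi> g)"
      "\<forall>g\<in>carrier G. rep_character G m R2 g = (\<Sum>\<psi>\<in>irreducible_characters G. d \<psi> * \<psi> g)"
      using less.IH *(1-4) by meson
    then show ?thesis
      using *(5) by (intro exI[of _ "\<lambda>\<psi>. c \<psi> + d \<psi>"]) (simp add: distrib_right sum.distrib)
  qed
qed

section \<open>The regular character\<close>

context finite_group
begin

text \<open>The right-hand side is the character of the regular representation. Pairing its
  expansion with an irreducible character \<open>\<phi>\<close> shows that the coefficient of
  \<open>\<phi>\<close> is \<open>\<phi> \<one>\<close>.\<close>

lemma regular_character_decomposition:
  assumes fin: "finite (irreducible_characters G)" and g: "g \<in> carrier G"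
  shows "(\<Sum>\<psi>\<in>irreducible_characters G. \<psi> \<one> * \<psi> g)
    = (if g = \<one> then of_nat (card (carrier G)) else 0)"
proof -
  let ?N = "card (carrier G)"
  obtain e where e: "bij_betw e {..<?N} (carrier G)"
    using ex_bij_betw_nat_finite[OF finite_carrier] by (auto simp: atLeast0LessThan)
  have e_mem: "e i \<in> carrier G" if "i < ?N" for i
    using e that by (auto dest: bij_betwE)
  have e_inj: "e i = e j \<longleftrightarrow> i = j" if "i < ?N" "j < ?N" for i j
    using e that by (auto simp: bij_betw_def inj_on_eq_iff)
  \<comment> \<open>The permutation matrix of left translation by \<open>g\<close>, in the
    enumeration \<open>e\<close> of the group.\<close>
  define R where "R g = mat ?N ?N (\<lambda>(i, j). if e i = g \<otimes> e j then 1 else 0 :: complex)" for g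
  have Rc: "R g \<in> carrier_mat ?N ?N" for g by (simp add: R_def)
  have "matrix_rep G ?N R"
    unfolding matrix_rep_def
  proof (intro conjI ballI Rc)
    show "R \<one> = 1\<^sub>m ?N"
      using e_mem e_inj by (intro eq_matI) (auto simp: R_def)
    fix g h assume g: "g \<in> carrier G" and h: "h \<in> carrier G"
    show "R (g \<otimes> h) = R g * R h"
    proof (rule eq_matI)
      fix i j assume "i < dim_row (R g * R h)" "j < dim_col (R g * R h)"
      then have ij: "i < ?N" "j < ?N" by (auto simp: R_def)
      have "(R g * R h) $$ (i, j)
          = (\<Sum>p<?N. if e p = h \<otimes> e j then if e i = g \<otimes> e p then 1 else 0 else 0)"
        unfolding mult_mat_entry[OF Rc Rc ij] using ij by (intro sum.cong) (auto simp: R_def)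
      also have "\<dots> = (\<Sum>x\<in>carrier G. if x = h \<otimes> e j then if e i = g \<otimes> x then 1 else 0 else 0)"
        by (rule sum.reindex_bij_betw[OF e])
      also have "\<dots> = R (g \<otimes> h) $$ (i, j)"
        using finite_carrier g h ij e_mem by (simp add: R_def m_assoc)
      finally show "R (g \<otimes> h) $$ (i, j) = (R g * R h) $$ (i, j)" by simp
    qed (auto simp: R_def)
  qed
  then obtain c where "\<forall>g\<in>carrier G.
      rep_character G ?N R g = (\<Sum>\<psi>\<in>irreducible_characters G. c \<psi> * \<psi> g)"
    using character_decomposition[OF _ fin] by blast
  \<comment> \<open>Left translation by \<open>g\<close> fixes an element only if \<open>g\<close>
    is the unit, and then it fixes all of them.\<close>
  moreover have "rep_character G ?N R g = (if g = \<one> then of_nat ?N else 0)" if "g \<in> carrier G" for g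
    using that e_mem by (auto simp: rep_character_def R_def)
  ultimately have c: "(\<Sum>\<psi>\<in>irreducible_characters G. c \<psi> * \<psi> g)
      = (if g = \<one> then of_nat ?N else 0)" if "g \<in> carrier G" for g
    using that by simp
  have "c \<phi> = \<phi> \<one>" if \<phi>: "\<phi> \<in> irreducible_characters G" for \<phi>
  proof -
    have "of_nat ?N * \<phi> \<one> = (\<Sum>g\<in>carrier G. if g = \<one> then of_nat ?N * \<phi> (inv g) else 0)"
      using finite_carrier by simp
    also have "\<dots>
        = (\<Sum>g\<in>carrier G. (\<Sum>\<psi>\<in>irreducible_characters G. c \<psi> * \<psi> g) * \<phi> (inv g))"
      by (intro sum.cong) (auto simp: c)
    also have "\<dots> = (\<Sum>\<psi>\<in>irreducible_characters G. c \<psi> * (\<Sum>g\<in>carrier G. \<psi> g * \<phi> (inv g)))"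
      by (simp add: sum_distrib_left sum_distrib_right mult.assoc) (rule sum.swap)
    also have "\<dots> = (\<Sum>\<psi>\<in>irreducible_characters G. if \<psi> = \<phi> then c \<psi> * of_nat ?N else 0)"
      by (intro sum.cong) (auto simp: character_orthogonality \<phi>)
    also have "\<dots> = c \<phi> * of_nat ?N" using fin \<phi> by simp
    finally show ?thesis using card_nonzero by simp
  qed
  then show ?thesis using c[OF g] by simp
qed

end

section \<open>The twisted Frobenius--Schur indicator\<close>

locale finite_group_antiautomorphism = finite_group +
  fixes L :: "'a \<Rightarrow> 'a"
  assumes involutive: "involutive_antiautomorphism G L"
begin

section \<open>The trace as a count of solutions\<close>

lemma L_closed [simp]: "g \<in> carrier G \<Longrightarrow> L g \<in> carrier G"
  using involutive bij_betwE unfolding involutive_antiautomorphism_def by blast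

lemma L_mult: "\<lbrakk>g \<in> carrier G; h \<in> carrier G\<rbrakk> \<Longrightarrow> L (g \<otimes> h) = L h \<otimes> L g"
  using involutive unfolding involutive_antiautomorphism_def by blast

lemma L_L [simp]: "g \<in> carrier G \<Longrightarrow> L (L g) = g"
  using involutive unfolding involutive_antiautomorphism_def by blast

lemma L_one [simp]: "L \<one> = \<one>"
  by (metis L_closed L_mult l_cancel_one one_closed r_one)

text \<open>\<open>L\<close> is its own inverse and exchanges the two solution sets, since
  \<open>inv (L h) \<otimes> h\<close> is the inverse of \<open>inv h \<otimes> L h\<close>.\<close>

lemma card_twisted_inv:
  assumes g: "g \<in> carrier G"
  shows "card {h \<in> carrier G. inv h \<otimes> L h = inv g} = card {h \<in> carrier G. inv h \<otimes> L h = g}"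
proof (rule bij_betw_same_card[OF bij_betwI[where f = L and g = L]])
  have *: "inv (L h) \<otimes> L (L h) = inv (inv h \<otimes> L h)" if "h \<in> carrier G" for h
    using that by (simp add: inv_mult_group)
  show "L \<in> {h \<in> carrier G. inv h \<otimes> L h = inv g} \<rightarrow> {h \<in> carrier G. inv h \<otimes> L h = g}"
    using * g by (auto simp del: L_L)
  show "L \<in> {h \<in> carrier G. inv h \<otimes> L h = g} \<rightarrow> {h \<in> carrier G. inv h \<otimes> L h = inv g}"
    using * by (auto simp del: L_L)
qed auto

text \<open>The diagonal entry at \<open>x\<close> is the delta function of \<open>x\<close>
  evaluated at \<open>L (x \<otimes> g)\<close>; applying \<open>L\<close> rewrites the condition
  \<open>L (x \<otimes> g) = x\<close> as \<open>x \<otimes> g = L x\<close>.\<close>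

lemma trace_regular_pullback:
  assumes g: "g \<in> carrier G"
  shows "L2_trace G (right_regular G g \<circ> pullback G L)
    = of_nat (card {h \<in> carrier G. inv h \<otimes> L h = g})"
proof -
  have iff: "L (x \<otimes> g) = x \<longleftrightarrow> inv x \<otimes> L x = g" if x: "x \<in> carrier G" for x
    using x g by (metis L_L L_closed m_closed inv_solve_left)
  have "L2_trace G (right_regular G g \<circ> pullback G L)
      = (\<Sum>x\<in>carrier G. if inv x \<otimes> L x = g then 1 else 0)"
    unfolding L2_trace_def using g
    by (intro sum.cong) (auto simp: right_regular_def pullback_def L2_delta_def iff)
  then show ?thesis using finite_carrier by (simp add: sum.If_cases Collect_conj_eq)
qed

lemma regular_pullback:
  assumes "g \<in> carrier G"
  shows "right_regular G g (pullback G L f) = pullback G L (left_regular G (inv (L g)) f)"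
  using assms by (auto simp: right_regular_def pullback_def left_regular_def L_mult fun_eq_iff)

text \<open>\<open>T\<close> is the Gram matrix of a bilinear form for which \<open>R (L g)\<close>
  is adjoint to \<open>R g\<close>; the sign \<open>c\<close> says whether this form is symmetric or
  antisymmetric.\<close>

lemma symmetric_or_antisymmetric_intertwiner:
  assumes R: "irreducible_matrix_rep G n R"
    and invariant: "\<And>g. g \<in> carrier G \<Longrightarrow> rep_character G n R (L g) = rep_character G n R g"
  obtains T U c where "T \<in> carrier_mat n n" "U \<in> carrier_mat n n" "U * T = 1\<^sub>m n"
    "\<And>g. g \<in> carrier G \<Longrightarrow> transpose_mat (R (L g)) = T * R g * U"
    "transpose_mat T = c \<cdot>\<^sub>m T" "c \<in> {1, - 1}"
proof -
  note R' = irreducible_matrix_repD[OF R]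
  note Rc = matrix_repD(1)[OF R'(1)]
  define S where "S g = transpose_mat (R (L g))" for g
  have Sc: "S g \<in> carrier_mat n n" if "g \<in> carrier G" for g
    using Rc[OF L_closed[OF that]] by (simp add: S_def)
  \<comment> \<open>Transposition and \<open>L\<close> both reverse products, so together they
    preserve them.\<close>
  have S: "matrix_rep G n S"
    unfolding matrix_rep_def
  proof (intro conjI ballI Sc)
    show "S \<one> = 1\<^sub>m n" using matrix_repD(2)[OF R'(1)] by (simp add: S_def)
    fix g h assume gh: "g \<in> carrier G" "h \<in> carrier G"
    then show "S (g \<otimes> h) = S g * S h"
      using matrix_repD(3)[OF R'(1), of "L h" "L g"] transpose_mult[OF Rc Rc, of "L h" "L g"]
      by (simp add: S_def L_mult)
  qed
  \<comment> \<open>If all averaged intertwiners vanished, the pairing of the characters of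
    \<open>S\<close> and \<open>R\<close> would be 0. By \<open>invariant\<close> the two characters
    agree, so the pairing is the group order.\<close>
  have "\<exists>j k. j < n \<and> k < n \<and> averaged n S n R j k \<noteq> 0\<^sub>m n n"
  proof (rule ccontr)
    assume "\<not> ?thesis"
    then have zero: "averaged n S n R j k = 0\<^sub>m n n" if "j < n" "k < n" for j k
      using that by blast
    have "(\<Sum>g\<in>carrier G. rep_character G n R g * rep_character G n R (inv g))
        = (\<Sum>g\<in>carrier G. rep_character G n R (L g) * rep_character G n R (inv g))"
      by (simp add: invariant)
    also have "\<dots> = (\<Sum>g\<in>carrier G. \<Sum>i<n. \<Sum>k<n. S g $$ (i, i) * R (inv g) $$ (k, k))"
    proof (rule sum.cong[OF refl])
      fix g assume g: "g \<in> carrier G"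
      show "rep_character G n R (L g) * rep_character G n R (inv g)
          = (\<Sum>i<n. \<Sum>k<n. S g $$ (i, i) * R (inv g) $$ (k, k))"
        using g Rc[OF L_closed[OF g]] by (simp add: rep_character_def S_def sum_product)
    qed
    also have "\<dots> = (\<Sum>i<n. \<Sum>g\<in>carrier G. \<Sum>k<n. S g $$ (i, i) * R (inv g) $$ (k, k))"
      by (rule sum.swap)
    also have "\<dots> = (\<Sum>i<n. \<Sum>k<n. \<Sum>g\<in>carrier G. S g $$ (i, i) * R (inv g) $$ (k, k))"
      by (intro sum.cong refl sum.swap)
    also have "\<dots> = (\<Sum>i<n. \<Sum>k<n. averaged n S n R i k $$ (i, k))"
      by (simp add: averaged_def)
    also have "\<dots> = 0" using zero by simp
    finally show False
      using character_orthogonality[of "rep_character G n R" "rep_character G n R"] R card_nonzero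
      unfolding irreducible_characters_def by auto
  qed
  then obtain j k where jk: "j < n" "k < n" "averaged n S n R j k \<noteq> 0\<^sub>m n n" by blast
  define T where "T = averaged n S n R j k"
  have T: "intertwines G n S n R T" "T \<noteq> 0\<^sub>m n n"
    using averaged_intertwines[OF S R'(1) jk(1,2)] jk(3) by (auto simp: T_def)
  then have Tc: "T \<in> carrier_mat n n" and Ti: "\<And>g. g \<in> carrier G \<Longrightarrow> S g * T = T * R g"
    unfolding intertwines_def by auto
  have "det T \<noteq> 0"
    using det_0_iff_vec_prod_zero[OF Tc] schur_injective[OF S R T] by blast
  then obtain U where Uc: "U \<in> carrier_mat n n" and TU: "T * U = 1\<^sub>m n" and UT: "U * T = 1\<^sub>m n"
    using inverse_mat_if_det_nonzero[OF Tc] by blast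
  let ?Tt = "transpose_mat T"
  have Ttc: "?Tt \<in> carrier_mat n n" using Tc by simp
  have S_eq: "S g = T * R g * U" if g: "g \<in> carrier G" for g
    using assoc_mult_mat[OF Sc[OF g] Tc Uc] TU Sc[OF g] by (simp flip: Ti[OF g])
  \<comment> \<open>Transposing the intertwining relation at \<open>L g\<close> interchanges the
    roles of \<open>R\<close> and \<open>S\<close>, because \<open>L (L g) = g\<close>.\<close>
  have Tti: "S g * ?Tt = ?Tt * R g" if g: "g \<in> carrier G" for g
  proof -
    have "transpose_mat (S (L g) * T) = transpose_mat (T * R (L g))"
      using Ti[of "L g"] g by simp
    then show ?thesis
      using transpose_mult[OF Sc Tc, of "L g"] transpose_mult[OF Tc Rc, of "L g"] g
      by (simp add: S_def)
  qed
  have "intertwines G n R n R (U * ?Tt)"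
    unfolding intertwines_def
  proof (intro conjI ballI)
    show "U * ?Tt \<in> carrier_mat n n" using Uc Ttc by simp
    fix g assume g: "g \<in> carrier G"
    have US: "U * S g = R g * U"
    proof -
      have "U * S g = U * (T * (R g * U))"
        using S_eq[OF g] assoc_mult_mat[OF Tc Rc[OF g] Uc] by simp
      also have "\<dots> = R g * U"
        using assoc_mult_mat[OF Uc Tc, of "R g * U" n] UT Rc[OF g] Uc by simp
      finally show ?thesis .
    qed
    have "R g * (U * ?Tt) = U * S g * ?Tt"
      using assoc_mult_mat[OF Rc[OF g] Uc Ttc] US by simp
    also have "\<dots> = U * (?Tt * R g)"
      using assoc_mult_mat[OF Uc Sc[OF g] Ttc] Tti[OF g] by simp
    also have "\<dots> = U * ?Tt * R g"
      using assoc_mult_mat[OF Uc Ttc Rc[OF g]] by simp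
    finally show "R g * (U * ?Tt) = U * ?Tt * R g" .
  qed
  then obtain c where c: "U * ?Tt = c \<cdot>\<^sub>m 1\<^sub>m n"
    using schur_scalar[OF R] by blast
  have "?Tt = T * (U * ?Tt)" using assoc_mult_mat[OF Tc Uc Ttc] TU Ttc by simp
  then have Tt: "?Tt = c \<cdot>\<^sub>m T"
    using c Tc mult_smult_distrib[OF Tc one_carrier_mat] by simp
  obtain p q where pq: "p < n" "q < n" "T $$ (p, q) \<noteq> 0"
    using T(2) Tc by (metis eq_matI carrier_matD index_zero_mat)
  have "T $$ (i, l) = c * T $$ (l, i)" if "i < n" "l < n" for i l
    using arg_cong[OF Tt, of "\<lambda>M. M $$ (l, i)"] that Tc by simp
  \<comment> \<open>Transposing twice gives the factor \<open>c * c\<close>, read off at a nonzero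
    entry of \<open>T\<close>.\<close>
  from this[OF pq(1,2)] this[OF pq(2,1)] have "T $$ (p, q) = c * c * T $$ (p, q)"
    by (metis mult.assoc)
  then have "c * c = 1" using pq(3) by simp
  then have "c \<in> {1, - 1}" by (simp add: square_eq_1_iff)
  then show ?thesis using that[OF Tc Uc UT _ Tt] S_eq by (simp add: S_def)
qed

text \<open>The sum of \<open>R (inv h) * R (L h)\<close> is a scalar matrix; multiplying by
  \<open>R x\<close> and taking traces gives the formula. The factor \<open>\<psi> \<one>\<close>,
  which is the dimension, clears the denominator.\<close>

lemma twisted_frobenius_schur:
  assumes \<psi>: "\<psi> \<in> irreducible_characters G"
    and invariant: "\<And>g. g \<in> carrier G \<Longrightarrow> \<psi> (L g) = \<psi> g"
  shows "\<exists>\<epsilon>\<in>{1, - 1}. \<forall>x\<in>carrier G.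
    \<psi> \<one> * (\<Sum>h\<in>carrier G. \<psi> (inv h \<otimes> L h \<otimes> x)) = \<epsilon> * of_nat (card (carrier G)) * \<psi> x"
proof -
  let ?N = "of_nat (card (carrier G)) :: complex"
  obtain n R where R: "irreducible_matrix_rep G n R" and \<psi>_def: "\<psi> = rep_character G n R"
    using \<psi> unfolding irreducible_characters_def by blast
  note R' = irreducible_matrix_repD[OF R]
  note Rc = matrix_repD(1)[OF R'(1)]
  obtain T U c where Tc: "T \<in> carrier_mat n n" and Uc: "U \<in> carrier_mat n n"
    and UT: "U * T = 1\<^sub>m n"
    and RL: "\<And>g. g \<in> carrier G \<Longrightarrow> transpose_mat (R (L g)) = T * R g * U"
    and Tt: "transpose_mat T = c \<cdot>\<^sub>m T" and c: "c \<in> {1, - 1}"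
    using symmetric_or_antisymmetric_intertwiner[OF R] invariant \<psi>_def by metis
  have RL_entry: "R (L h) $$ (j, m) = (\<Sum>k<n. \<Sum>l<n. T $$ (m, l) * R h $$ (l, k) * U $$ (k, j))"
    if h: "h \<in> carrier G" and "j < n" "m < n" for h j m
  proof -
    have "R (L h) $$ (j, m) = (T * R h * U) $$ (m, j)"
      using that Rc[OF L_closed[OF h]] by (simp flip: RL)
    also have "\<dots> = (\<Sum>k<n. (T * R h) $$ (m, k) * U $$ (k, j))"
      using that Tc Uc Rc[OF h] by (intro mult_mat_entry[of _ n]) auto
    also have "\<dots> = (\<Sum>k<n. \<Sum>l<n. T $$ (m, l) * R h $$ (l, k) * U $$ (k, j))"
      using that mult_mat_entry[OF Tc Rc[OF h]] by (simp add: sum_distrib_right del: index_mult_mat(1))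
    finally show ?thesis .
  qed
  have scalar: "(\<Sum>h\<in>carrier G. \<Sum>j<n. R (inv h) $$ (i, j) * R (L h) $$ (j, m))
      = (if i = m then c * (?N / of_nat n) else 0)" if i: "i < n" and m: "m < n" for i m
  proof -
    have "(\<Sum>h\<in>carrier G. \<Sum>j<n. R (inv h) $$ (i, j) * R (L h) $$ (j, m))
        = (\<Sum>h\<in>carrier G. \<Sum>j<n. \<Sum>k<n. \<Sum>l<n.
            T $$ (m, l) * U $$ (k, j) * (R h $$ (l, k) * R (inv h) $$ (i, j)))"
      using m by (simp add: RL_entry sum_distrib_left ac_simps)
    also have "\<dots> = (\<Sum>j<n. \<Sum>k<n. \<Sum>l<n. \<Sum>h\<in>carrier G.
            T $$ (m, l) * U $$ (k, j) * (R h $$ (l, k) * R (inv h) $$ (i, j)))"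
      \<comment> \<open>The group sum moves innermost, where orthogonality applies and leaves only
        \<open>l = j\<close> and \<open>k = i\<close>.\<close>
      by (simp only: sum.swap[where A = "carrier G"])
    also have "\<dots> = (\<Sum>j<n. \<Sum>k<n. \<Sum>l<n. T $$ (m, l) * U $$ (k, j)
            * (if l = j \<and> k = i then ?N / of_nat n else 0))"
      using i by (simp add: schur_orthogonality_same[OF R] flip: sum_distrib_left)
    also have "\<dots> = (\<Sum>j<n. \<Sum>k<n. \<Sum>l<n. if l = j
            then if k = i then T $$ (m, l) * U $$ (k, j) * (?N / of_nat n) else 0 else 0)"
      by (intro sum.cong refl) simp
    also have "\<dots> = (\<Sum>j<n. T $$ (m, j) * U $$ (i, j) * (?N / of_nat n))"
      using i by simp
    \<comment> \<open>The symmetry of \<open>T\<close> up to the sign \<open>c\<close> puts the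
      indices in the order of the product \<open>U * T\<close>, which is the identity.\<close>
    also have "\<dots> = (\<Sum>j<n. c * (U $$ (i, j) * T $$ (j, m)) * (?N / of_nat n))"
    proof (rule sum.cong[OF refl])
      fix j assume "j \<in> {..<n}"
      then have "T $$ (m, j) = c * T $$ (j, m)"
        using arg_cong[OF Tt, of "\<lambda>M. M $$ (j, m)"] m Tc by simp
      then show "T $$ (m, j) * U $$ (i, j) * (?N / of_nat n)
          = c * (U $$ (i, j) * T $$ (j, m)) * (?N / of_nat n)" by simp
    qed
    also have "\<dots> = c * (\<Sum>j<n. U $$ (i, j) * T $$ (j, m)) * (?N / of_nat n)"
      by (simp add: sum_distrib_left sum_distrib_right sum_divide_distrib)
    also have "(\<Sum>j<n. U $$ (i, j) * T $$ (j, m)) = (1\<^sub>m n :: complex mat) $$ (i, m)"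
      using mult_mat_entry[OF Uc Tc i m] UT by simp
    finally show ?thesis using i m by simp
  qed
  have "\<psi> \<one> * (\<Sum>h\<in>carrier G. \<psi> (inv h \<otimes> L h \<otimes> x)) = c * ?N * \<psi> x" if x: "x \<in> carrier G" for x
  proof -
    have expand: "\<psi> (inv h \<otimes> L h \<otimes> x)
        = (\<Sum>i<n. \<Sum>m<n. (\<Sum>j<n. R (inv h) $$ (i, j) * R (L h) $$ (j, m)) * R x $$ (m, i))"
      if h: "h \<in> carrier G" for h
    proof -
      have hL: "inv h \<in> carrier G" "L h \<in> carrier G" using h by auto
      have "R (inv h \<otimes> L h \<otimes> x) = R (inv h) * R (L h) * R x"
        using matrix_repD(3)[OF R'(1)] hL x by simp
      moreover have "(R (inv h) * R (L h) * R x) $$ (i, i)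
          = (\<Sum>m<n. (R (inv h) * R (L h)) $$ (i, m) * R x $$ (m, i))" if "i < n" for i
        by (rule mult_mat_entry[OF mult_carrier_mat[OF Rc[OF hL(1)] Rc[OF hL(2)]] Rc[OF x] that that])
      ultimately show ?thesis
        using hL x mult_mat_entry[OF Rc[OF hL(1)] Rc[OF hL(2)]]
        by (simp add: \<psi>_def rep_character_def del: index_mult_mat(1))
    qed
    have "(\<Sum>h\<in>carrier G. \<psi> (inv h \<otimes> L h \<otimes> x))
        = (\<Sum>i<n. \<Sum>m<n. \<Sum>h\<in>carrier G.
            (\<Sum>j<n. R (inv h) $$ (i, j) * R (L h) $$ (j, m)) * R x $$ (m, i))"
      by (simp add: expand sum.swap[where A = "carrier G"])
    also have "\<dots> = (\<Sum>i<n. \<Sum>m<n. if i = m then c * (?N / of_nat n) * R x $$ (m, i) else 0)"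
      by (intro sum.cong refl) (simp add: scalar flip: sum_distrib_right)
    also have "\<dots> = c * (?N / of_nat n) * \<psi> x"
      using x by (simp add: \<psi>_def rep_character_def sum_distrib_left)
    finally have "(\<Sum>h\<in>carrier G. \<psi> (inv h \<otimes> L h \<otimes> x)) = c * (?N / of_nat n) * \<psi> x" .
    moreover have "\<psi> \<one> = of_nat n"
      using matrix_repD(2)[OF R'(1)] by (simp add: \<psi>_def rep_character_def)
    ultimately show ?thesis using R'(2) by simp
  qed
  then show ?thesis using c by blast
qed

end

section \<open>From conjugacy of \<open>L g\<close> and \<open>g\<close> to the signed character
  sum\<close>

lemma (in group) irreducible_character_conjugate:
  assumes \<psi>: "\<psi> \<in> irreducible_characters G" and "conjugate_in G a b" and b: "b \<in> carrier G"
  shows "\<psi> a = \<psi> b"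
proof -
  obtain n R where R: "irreducible_matrix_rep G n R" and \<psi>_def: "\<psi> = rep_character G n R"
    using \<psi> unfolding irreducible_characters_def by blast
  note R' = irreducible_matrix_repD(1)[OF R]
  obtain x where x: "x \<in> carrier G" and a: "a = x \<otimes> b \<otimes> inv x"
    using assms(2) unfolding conjugate_in_def by blast
  have "R a = R x * R b * R (inv x)" using matrix_repD(3)[OF R'] x b a by simp
  moreover have "R (inv x) * R x = 1\<^sub>m n"
    using matrix_repD(3)[OF R' inv_closed[OF x] x] matrix_repD(2)[OF R'] x by simp
  ultimately have "mat_trace (R a) = mat_trace (R b)"
    using mat_trace_similar matrix_repD(1)[OF R'] x b inv_closed by metis
  then show ?thesis using rep_character_trace[OF R'] x b a \<psi>_def by simp
qed

theorem theorem2: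
  fixes G :: "('a, 'b) monoid_scheme" (structure)
    and L :: "'a \<Rightarrow> 'a"
    and r :: nat and \<chi> :: "nat \<Rightarrow> 'a \<Rightarrow> complex"
  assumes "group G" and "finite (carrier G)"
    and "involutive_antiautomorphism G L"
    and "\<forall>g\<in>carrier G. conjugate_in G (L g) g"
    and "bij_betw \<chi> {1..r} (irreducible_characters G)"
  shows "(\<forall>g\<in>carrier G. \<forall>f\<in>L2 G.
            (right_regular G g \<circ> pullback G L) f = (pullback G L \<circ> left_regular G (inv (L g))) f) \<and>
         (\<forall>g\<in>carrier G. L2_trace G (right_regular G g \<circ> pullback G L)
            = of_nat (card {h \<in> carrier G. inv h \<otimes> L h = g})) \<and>
         (\<forall>g\<in>carrier G. L2_trace G (right_regular G g \<circ> pullback G L)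
            = L2_trace G (right_regular G (inv g) \<circ> pullback G L)) \<and>
         (\<exists>\<epsilon> :: nat \<Rightarrow> complex. (\<forall>k\<in>{1..r}. \<epsilon> k \<in> {1, - 1}) \<and>
            (\<forall>g\<in>carrier G. L2_trace G (right_regular G g \<circ> pullback G L)
               = (\<Sum>k=1..r. \<epsilon> k * \<chi> k g)))"
proof -
  interpret group G by fact
  interpret finite_group_antiautomorphism G L
    by unfold_locales (use assms in auto)
  let ?I = "irreducible_characters G" and ?N = "of_nat (card (carrier G)) :: complex"
  let ?Tr = "\<lambda>g. L2_trace G (right_regular G g \<circ> pullback G L)"
  have fin: "finite ?I" using assms(5) bij_betw_finite by blast
  have inv_trace: "?Tr g = ?Tr (inv g)" if "g \<in> carrier G" for g
    using that by (simp add: trace_regular_pullback card_twisted_inv)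
  have "\<exists>\<epsilon>\<in>{1, - 1}. \<forall>x\<in>carrier G.
      \<psi> \<one> * (\<Sum>h\<in>carrier G. \<psi> (inv h \<otimes> L h \<otimes> x)) = \<epsilon> * ?N * \<psi> x" if "\<psi> \<in> ?I" for \<psi>
    using twisted_frobenius_schur[OF that] irreducible_character_conjugate[OF that] assms(4)
    by blast
  then obtain e where e: "\<And>\<psi>. \<psi> \<in> ?I \<Longrightarrow> e \<psi> \<in> {1, - 1}"
    "\<And>\<psi> x. \<lbrakk>\<psi> \<in> ?I; x \<in> carrier G\<rbrakk> \<Longrightarrow>
       \<psi> \<one> * (\<Sum>h\<in>carrier G. \<psi> (inv h \<otimes> L h \<otimes> x)) = e \<psi> * ?N * \<psi> x"
    by metis
  \<comment> \<open>The inverse arises because \<open>inv h \<otimes> L h \<otimes> x\<close> is the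
    unit exactly when \<open>inv h \<otimes> L h\<close> equals \<open>inv x\<close>;
    \<open>inv_trace\<close> removes it afterwards.\<close>
  have trace: "?Tr (inv x) = (\<Sum>\<psi>\<in>?I. e \<psi> * \<psi> x)" if x: "x \<in> carrier G" for x
  proof -
    have iff: "inv h \<otimes> L h \<otimes> x = \<one> \<longleftrightarrow> inv h \<otimes> L h = inv x" if "h \<in> carrier G" for h
      using that x by (metis L_closed inv_closed inv_equality inv_inv l_inv m_closed)
    have "?N * ?Tr (inv x) = (\<Sum>h\<in>carrier G. if inv h \<otimes> L h \<otimes> x = \<one> then ?N else 0)"
      using x finite_carrier
      by (simp add: trace_regular_pullback iff sum.If_cases Collect_conj_eq cong: if_cong)
    also have "\<dots> = (\<Sum>h\<in>carrier G. \<Sum>\<psi>\<in>?I. \<psi> \<one> * \<psi> (inv h \<otimes> L h \<otimes> x))"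
      using x by (intro sum.cong) (simp_all add: regular_character_decomposition[OF fin])
    also have "\<dots> = (\<Sum>\<psi>\<in>?I. \<psi> \<one> * (\<Sum>h\<in>carrier G. \<psi> (inv h \<otimes> L h \<otimes> x)))"
      by (subst sum.swap) (simp add: sum_distrib_left)
    also have "\<dots> = ?N * (\<Sum>\<psi>\<in>?I. e \<psi> * \<psi> x)"
      using e(2) x by (simp add: sum_distrib_left ac_simps)
    finally show ?thesis using card_nonzero by simp
  qed
  \<comment> \<open>The bijection \<open>\<chi>\<close> carries the sum over the set of characters
    to the given enumeration, and the sign attached to index \<open>k\<close> is that of
    \<open>\<chi> k\<close>.\<close>
  have "?Tr g = (\<Sum>k=1..r. e (\<chi> k) * \<chi> k g)" if "g \<in> carrier G" for g
    using inv_trace[OF that] trace[OF that]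
      sum.reindex_bij_betw[OF assms(5), of "\<lambda>\<psi>. e \<psi> * \<psi> g"] by simp
  moreover have "e (\<chi> k) \<in> {1, - 1}" if "k \<in> {1..r}" for k
    using e(1) assms(5) that bij_betwE by blast
  ultimately have "\<exists>\<epsilon> :: nat \<Rightarrow> complex. (\<forall>k\<in>{1..r}. \<epsilon> k \<in> {1, - 1}) \<and>
      (\<forall>g\<in>carrier G. ?Tr g = (\<Sum>k=1..r. \<epsilon> k * \<chi> k g))"
    by (intro exI[of _ "\<lambda>k. e (\<chi> k)"] conjI ballI)
  moreover have "\<forall>g\<in>carrier G. \<forall>f\<in>L2 G.
      (right_regular G g \<circ> pullback G L) f = (pullback G L \<circ> left_regular G (inv (L g))) f"
    by (simp add: regular_pullback)
  ultimately show ?thesis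
    using trace_regular_pullback inv_trace by blast
qed

end
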